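(* Let $(\Omega,\mathcal A)$ be a measurable space and let $X$ be a (non-empty) compact metric space. If $g:\Omega\times X\to\mathbb{C}^n$ is a random continuous function on $X$, then $X^g:\omega\mapsto X^g(\omega):=g(\omega,X)=\{g(\omega,x):x\in X\}$ is a random compact set in $\mathbb{C}^n$.
   Context: A function $g:\Omega\times X\to\mathbb{C}^n$ is a random continuous function on $X$ if $g(\cdot,x):\Omega\to\mathbb{C}^n$ is measurable (Borel $\sigma$-algebra on $\mathbb{C}^n$) for each $x\in X$ and $g(\omega,\cdot)$ is continuous on $X$ for each $\omega\in\Omega$. $\mathcal K'(\mathbb{C}^n)$ denotes the space of non-empty compact subsets of $\mathbb{C}^n$ with the Hausdorff distance and its Borel $\sigma$-algebra. A random compact set in $\mathbb{C}^n$ is a measurable function $\Omega\to\mathcal K'(\mathbb{C}^n)$. *)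

theory Defs
  imports "HOL-Analysis.Analysis"
begin

definition nonempty_compacts :: "'a::metric_space set set" where
  "nonempty_compacts = {K. compact K \<and> K \<noteq> {}}"

text \<open>
  The value 0 away from non-empty compact sets is a convention: \<^locale>\<open>Metric_space\<close> requires
  its distance to be non-negative on the whole type, and the suprema below are unspecified for
  unbounded sets.
\<close>

definition hausdorff_dist :: "'a::metric_space set \<Rightarrow> 'a set \<Rightarrow> real" where
  "hausdorff_dist A B =
     (if A \<in> nonempty_compacts \<and> B \<in> nonempty_compacts
      then max (SUP a\<in>A. infdist a B) (SUP b\<in>B. infdist b A) else 0)"

lemma hausdorff_dist_le_iff:
  assumes A: "A \<in> nonempty_compacts" and B: "B \<in> nonempty_compacts"
  shows "hausdorff_dist A B \<le> r \<longleftrightarrow> (\<forall>a\<in>A. infdist a B \<le> r) \<and> (\<forall>b\<in>B. infdist b A \<le> r)"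
proof -
  have bdd: "bdd_above ((\<lambda>x. infdist x T) ` S)" if "compact S" for S T :: "'a set"
    using that by (intro bounded_imp_bdd_above compact_imp_bounded compact_continuous_image
        continuous_on_infdist continuous_on_id)
  show ?thesis
    using A B by (simp add: hausdorff_dist_def nonempty_compacts_def cSUP_le_iff bdd)
qed

lemma Metric_space_hausdorff_dist:
  "Metric_space (nonempty_compacts :: 'a::metric_space set set) hausdorff_dist"
proof
  have ne: "hausdorff_dist A B \<ge> 0"
    if A: "A \<in> nonempty_compacts" and B: "B \<in> nonempty_compacts" for A B :: "'a set"
  proof -
    obtain a where "a \<in> A" using A by (auto simp: nonempty_compacts_def)
    then have "infdist a B \<le> hausdorff_dist A B"
      using hausdorff_dist_le_iff[OF A B, of "hausdorff_dist A B"] by simp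
    then show ?thesis using infdist_nonneg[of a B] by linarith
  qed
  then show "0 \<le> hausdorff_dist A B" for A B :: "'a set"
    by (cases "A \<in> nonempty_compacts \<and> B \<in> nonempty_compacts") (auto simp: hausdorff_dist_def)
  show "hausdorff_dist A B = hausdorff_dist B A" for A B :: "'a set"
    by (auto simp: hausdorff_dist_def max.commute)
  show "hausdorff_dist A B = 0 \<longleftrightarrow> A = B"
    if A: "A \<in> nonempty_compacts" and B: "B \<in> nonempty_compacts" for A B :: "'a set"
  proof -
    have cl: "closed A" "closed B" "A \<noteq> {}" "B \<noteq> {}"
      using A B by (auto simp: nonempty_compacts_def compact_imp_closed)
    have "hausdorff_dist A B = 0 \<longleftrightarrow> hausdorff_dist A B \<le> 0"
      using ne[OF A B] by linarith
    also have "\<dots> \<longleftrightarrow> (\<forall>a\<in>A. infdist a B = 0) \<and> (\<forall>b\<in>B. infdist b A = 0)"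
      unfolding hausdorff_dist_le_iff[OF A B] by (simp add: infdist_nonneg order.eq_iff)
    also have "\<dots> \<longleftrightarrow> A = B"
      using cl by (auto simp flip: in_closed_iff_infdist_zero)
    finally show ?thesis .
  qed
  have one: "infdist a C \<le> hausdorff_dist A B + hausdorff_dist B C"
    if A: "A \<in> nonempty_compacts" and B: "B \<in> nonempty_compacts" and C: "C \<in> nonempty_compacts"
      and a: "a \<in> A" for A B C :: "'a set" and a
  proof -
    have "compact B" "B \<noteq> {}" using B by (auto simp: nonempty_compacts_def)
    moreover have "continuous_on B (dist a)" by (intro continuous_intros)
    ultimately obtain b where b: "b \<in> B" and min: "\<And>y. y \<in> B \<Longrightarrow> dist a b \<le> dist a y"
      using continuous_attains_inf[of B "dist a"] by blast
    have "dist a b \<le> infdist a B"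
      using \<open>B \<noteq> {}\<close> min by (auto simp: infdist_def intro: cINF_greatest)
    have "infdist a C \<le> infdist b C + dist a b" by (rule infdist_triangle)
    moreover have "infdist b C \<le> hausdorff_dist B C"
      using hausdorff_dist_le_iff[OF B C, of "hausdorff_dist B C"] b by simp
    moreover have "dist a b \<le> hausdorff_dist A B"
      using hausdorff_dist_le_iff[OF A B, of "hausdorff_dist A B"]
        a \<open>dist a b \<le> infdist a B\<close> by fastforce
    ultimately show ?thesis by linarith
  qed
  have sym: "hausdorff_dist A B = hausdorff_dist B A" for A B :: "'a set"
    by (auto simp: hausdorff_dist_def max.commute)
  show "hausdorff_dist A C \<le> hausdorff_dist A B + hausdorff_dist B C"
    if A: "A \<in> nonempty_compacts" and B: "B \<in> nonempty_compacts" and C: "C \<in> nonempty_compacts"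
    for A B C :: "'a set"
    unfolding hausdorff_dist_le_iff[OF A C]
    using one[OF A B C] one[OF C B A] by (simp add: sym add.commute)
qed

definition hausdorff_borel :: "'a::metric_space set measure" where
  "hausdorff_borel =
     sigma nonempty_compacts
       {U. openin (Metric_space.mtopology nonempty_compacts hausdorff_dist) U}"

lemma space_hausdorff_borel: "space hausdorff_borel = nonempty_compacts"
  by (simp add: hausdorff_borel_def space_measure_of_conv)

lemma sets_hausdorff_borel:
  "sets hausdorff_borel =
     sigma_sets nonempty_compacts
       {U. openin (Metric_space.mtopology nonempty_compacts hausdorff_dist) U}"
  unfolding hausdorff_borel_def
  by (rule sets_measure_of)
    (use openin_subset Metric_space.topspace_mtopology[OF Metric_space_hausdorff_dist] in blast)

definition random_continuous_function ::
  "'w measure \<Rightarrow> 'x::topological_space set \<Rightarrow> ('w \<Rightarrow> 'x \<Rightarrow> complex ^ 'n) \<Rightarrow> bool" where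
  "random_continuous_function M X g \<longleftrightarrow>
     (\<forall>x\<in>X. (\<lambda>\<omega>. g \<omega> x) \<in> M \<rightarrow>\<^sub>M borel) \<and>
     (\<forall>\<omega>\<in>space M. continuous_on X (g \<omega>))"

text \<open>
  Of \<open>M\<close> only \<^term>\<open>space M\<close> and \<^term>\<open>sets M\<close> matter below; measurability into
  \<^const>\<open>hausdorff_borel\<close> includes that the values are non-empty compact sets.
\<close>

definition random_compact_set :: "'w measure \<Rightarrow> ('w \<Rightarrow> (complex ^ 'n) set) \<Rightarrow> bool" where
  "random_compact_set M K \<longleftrightarrow> K \<in> M \<rightarrow>\<^sub>M hausdorff_borel"

end

(* The Hausdorff metric space of non-empty compact sets is separable: the non-empty finite subsets
   of a countable dense set are dense.  Hence every open set is a countable union of balls around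
   such finite sets F, and it is enough that the distance from F to the image g(omega, X) is
   measurable in omega.  This distance is built from an infimum and a supremum over X of continuous
   functions, and these may be taken over a countable dense subset of X. *)
theory Submission
  imports Defs
begin

text \<open>Total boundedness gives a finite \<open>1 / Suc n\<close>-net for every
  \<open>n\<close>, and the union of these nets is dense. The nets are chosen inside
  \<open>X\<close>, where \<open>g\<close> is assumed measurable and continuous.\<close>

lemma compact_countable_dense:
  fixes X :: "'a::metric_space set"
  assumes "compact X"
  obtains D where "countable D" "D \<subseteq> X" "X \<subseteq> closure D"
proof -
  have "\<exists>k. finite k \<and> k \<subseteq> X \<and> X \<subseteq> (\<Union>x\<in>k. ball x (1 / Suc n))" for n
    using seq_compact_imp_totally_bounded[of X] assms
    unfolding compact_eq_seq_compact_metric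
    by (metis of_nat_0_less_iff zero_less_Suc zero_less_divide_1_iff)
  then obtain k where k: "\<And>n. finite (k n)" "\<And>n. k n \<subseteq> X"
      "\<And>n. X \<subseteq> (\<Union>x\<in>k n. ball x (1 / Suc n))"
    by metis
  show thesis
  proof
    show "countable (\<Union>n. k n)"
      using k(1) by (auto intro: countable_finite)
    show "(\<Union>n. k n) \<subseteq> X"
      using k(2) by blast
    show "X \<subseteq> closure (\<Union>n. k n)"
    proof
      fix x assume x: "x \<in> X"
      show "x \<in> closure (\<Union>n. k n)"
        unfolding closure_approachable
      proof (intro allI impI)
        fix e :: real assume "0 < e"
        then obtain n where n: "1 / Suc n < e"
          using nat_approx_posE by blast
        obtain y where "y \<in> k n" "dist y x < 1 / Suc n"
          using k(3)[of n] x by auto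
        then show "\<exists>y\<in>\<Union>n. k n. dist y x < e"
          using n by (intro bexI[of _ y]) auto
      qed
    qed
  qed
qed

text \<open>The set where \<open>f\<close> is below \<open>c\<close> is relatively open in
  \<open>X\<close>, so it meets \<open>D\<close> as soon as it is non-empty. This turns conditions
  over the possibly uncountable \<open>X\<close> into countable ones.\<close>

lemma ex_less_dense_iff:
  fixes f :: "'a::metric_space \<Rightarrow> real"
  assumes f: "continuous_on X f" and D: "D \<subseteq> X" "X \<subseteq> closure D"
  shows "(\<exists>x\<in>X. f x < c) \<longleftrightarrow> (\<exists>x\<in>D. f x < c)"
proof
  assume "\<exists>x\<in>X. f x < c"
  then obtain x where x: "x \<in> X" "f x < c" by blast
  then obtain d where d: "d > 0" "\<And>y. y \<in> X \<Longrightarrow> dist y x < d \<Longrightarrow> dist (f y) (f x) < c - f x"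
    using f unfolding continuous_on_iff by (metis diff_gt_0_iff_gt)
  obtain y where y: "y \<in> D" "dist y x < d"
    using x D d(1) by (meson closure_approachable subsetD)
  then have "dist (f y) (f x) < c - f x"
    using d(2) D(1) by blast
  then have "f y < c"
    by (simp add: dist_real_def)
  with y show "\<exists>x\<in>D. f x < c" by blast
qed (use D in blast)

text \<open>A compact set is close to a finite net of its own points, and each net point can be
  moved slightly into \<open>Q\<close>. For countable \<open>Q\<close> there are only countably many
  such \<open>F\<close>, which gives separability of the Hausdorff metric.\<close>

lemma finite_subset_dense_hausdorff:
  fixes K :: "'a::metric_space set"
  assumes K: "K \<in> nonempty_compacts" and Q: "closure Q = UNIV" and e: "e > 0"
  obtains F where "finite F" "F \<subseteq> Q" "F \<in> nonempty_compacts" "hausdorff_dist F K < e"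
proof -
  have K': "compact K" "K \<noteq> {}" using K by (auto simp: nonempty_compacts_def)
  \<comment> \<open>The net and the move into \<open>Q\<close> each cost at most \<open>e/4\<close>.
    The resulting bound \<open>e/2\<close> leaves room for the strict inequality, since
    \<open>hausdorff_dist_le_iff\<close> yields non-strict bounds only.\<close>
  obtain k where k: "finite k" "k \<subseteq> K" "K \<subseteq> (\<Union>x\<in>k. ball x (e/4))"
    using seq_compact_imp_totally_bounded[of K] K' e
    unfolding compact_eq_seq_compact_metric
    by (metis divide_pos_pos zero_less_numeral)
  have "\<exists>q\<in>Q. dist q x < e/4" for x
    using Q e by (metis UNIV_I closure_approachable divide_pos_pos zero_less_numeral)
  then obtain q where q: "\<And>x. q x \<in> Q" "\<And>x. dist (q x) x < e/4" by metis
  have F: "q ` k \<in> nonempty_compacts"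
    using k K' by (auto simp: nonempty_compacts_def finite_imp_compact)
  have "hausdorff_dist (q ` k) K \<le> e/2"
    unfolding hausdorff_dist_le_iff[OF F K]
  proof (intro conjI ballI)
    fix a assume "a \<in> q ` k"
    then obtain x where x: "x \<in> k" "a = q x" by blast
    then have "infdist a K \<le> dist a x" using k by (intro infdist_le) auto
    then show "infdist a K \<le> e/2" using q(2)[of x] x(2) e by auto
  next
    fix b assume "b \<in> K"
    then obtain x where x: "x \<in> k" "dist x b < e/4" using k(3) by auto
    then have "infdist b (q ` k) \<le> dist b (q x)" by (intro infdist_le) auto
    also have "\<dots> \<le> dist x b + dist (q x) x"
      by (metis dist_commute dist_triangle add.commute)
    finally show "infdist b (q ` k) \<le> e/2" using q(2)[of x] x by linarith
  qed
  then show thesis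
    using that[of "q ` k"] k(1) F q(1) e by auto
qed

text \<open>It suffices to treat preimages of open sets. By separability these are countable unions
  of sublevel sets of the distances to finite sets.\<close>

lemma measurable_hausdorff_borelI:
  fixes K :: "'w \<Rightarrow> 'a::{metric_space, second_countable_topology} set"
  assumes K: "\<And>\<omega>. \<omega> \<in> space M \<Longrightarrow> K \<omega> \<in> nonempty_compacts"
    and dist: "\<And>F. finite F \<Longrightarrow> F \<in> nonempty_compacts \<Longrightarrow>
      (\<lambda>\<omega>. hausdorff_dist F (K \<omega>)) \<in> borel_measurable M"
  shows "K \<in> M \<rightarrow>\<^sub>M hausdorff_borel"
proof (rule measurable_sigma_sets[OF sets_hausdorff_borel])
  interpret H: Metric_space "nonempty_compacts :: 'a set set" hausdorff_dist
    by (rule Metric_space_hausdorff_dist)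
  show "{U. openin H.mtopology U} \<subseteq> Pow nonempty_compacts"
    by (auto simp: H.openin_mtopology)
  show "K \<in> space M \<rightarrow> nonempty_compacts" using K by blast
  fix U assume "U \<in> {U. openin H.mtopology U}"
  then have U: "U \<subseteq> nonempty_compacts" "\<And>A. A \<in> U \<Longrightarrow> \<exists>r>0. H.mball A r \<subseteq> U"
    by (auto simp: H.openin_mtopology)
  obtain Q :: "'a set" where Q: "countable Q" "\<And>X. open X \<Longrightarrow> X \<noteq> {} \<Longrightarrow> \<exists>d\<in>Q. d \<in> X"
    by (rule countable_dense_setE) blast
  have cl: "closure Q = UNIV"
  proof (intro UNIV_eq_I[symmetric])
    fix x show "x \<in> closure Q"
      unfolding closure_approachable
      using Q(2)[of "ball x _"] by (force simp: dist_commute)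
  qed
  \<comment> \<open>The index set of the balls that will exhaust \<open>U\<close>: centres are
    finite subsets of \<open>Q\<close> and radii are reciprocals, so there are countably many,
    chosen independently of \<open>\<omega>\<close>.\<close>
  define S where "S = {(F, n). finite F \<and> F \<subseteq> Q \<and> F \<in> nonempty_compacts \<and>
    H.mball F (1 / real (Suc n)) \<subseteq> U}"
  have "S \<subseteq> {F. finite F \<and> F \<subseteq> Q} \<times> UNIV"
    by (auto simp: S_def)
  then have S: "countable S"
    by (rule countable_subset) (intro countable_SIGMA countable_Collect_finite_subset Q(1) countableI_type)
  have "K -` U \<inter> space M =
    (\<Union>(F, n)\<in>S. {\<omega> \<in> space M. hausdorff_dist F (K \<omega>) < 1 / real (Suc n)})"
  proof (intro equalityI subsetI)
    fix \<omega> assume w: "\<omega> \<in> K -` U \<inter> space M"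
    then obtain r where r: "r > 0" "H.mball (K \<omega>) r \<subseteq> U" using U(2) by blast
    \<comment> \<open>Half of \<open>r\<close>, because the triangle inequality through
      \<open>F\<close> uses the radius \<open>1 / Suc n\<close> twice: from
      \<open>K \<omega>\<close> to \<open>F\<close> and from \<open>F\<close> to
      \<open>A\<close>.\<close>
    obtain n where n: "1 / Suc n < r/2"
      using r nat_approx_posE[of "r/2"] by auto
    obtain F where F: "finite F" "F \<subseteq> Q" "F \<in> nonempty_compacts"
        "hausdorff_dist F (K \<omega>) < 1 / Suc n"
      using finite_subset_dense_hausdorff[OF K cl, of \<omega> "1 / Suc n"] w by auto
    have "H.mball F (1 / Suc n) \<subseteq> H.mball (K \<omega>) r"
    proof
      fix A assume A: "A \<in> H.mball F (1 / Suc n)"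
      have "hausdorff_dist (K \<omega>) A \<le> hausdorff_dist (K \<omega>) F + hausdorff_dist F A"
        using A F K w by (intro H.triangle) auto
      also have "\<dots> < r"
        using A F(4) n H.commute[of F "K \<omega>"] by (simp add: H.in_mball)
      finally show "A \<in> H.mball (K \<omega>) r"
        using A K w by auto
    qed
    then have "(F, n) \<in> S"
      using F r by (auto simp: S_def)
    then show "\<omega> \<in> (\<Union>(F, n)\<in>S. {\<omega> \<in> space M. hausdorff_dist F (K \<omega>) < 1 / real (Suc n)})"
      using F(4) w by blast
  next
    fix \<omega> assume "\<omega> \<in> (\<Union>(F, n)\<in>S. {\<omega> \<in> space M. hausdorff_dist F (K \<omega>) < 1 / real (Suc n)})"
    then obtain F n where "(F, n) \<in> S" "\<omega> \<in> space M" "hausdorff_dist F (K \<omega>) < 1 / real (Suc n)"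
      by blast
    moreover from this have "K \<omega> \<in> H.mball F (1 / real (Suc n))"
      using K by (simp add: S_def H.in_mball)
    ultimately show "\<omega> \<in> K -` U \<inter> space M"
      by (auto simp: S_def)
  qed
  moreover have "{\<omega> \<in> space M. hausdorff_dist F (K \<omega>) < 1 / real (Suc n)} \<in> sets M"
    if "(F, n) \<in> S" for F n
  proof -
    have [measurable]: "(\<lambda>\<omega>. hausdorff_dist F (K \<omega>)) \<in> borel_measurable M"
      using that by (intro dist) (auto simp: S_def)
    show ?thesis by measurable
  qed
  ultimately show "K -` U \<inter> space M \<in> sets M"
    using S by (auto intro!: sets.countable_UN')
qed

text \<open>A bound on the Hausdorff distance splits into a finite conjunction over \<open>F\<close>
  and a conjunction over \<open>X\<close>. Continuity of \<open>g \<omega>\<close> reduces the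
  latter, and the infimum inside the former, to the countable set \<open>D\<close>.\<close>

lemma measurable_hausdorff_dist_image:
  fixes g :: "'w \<Rightarrow> 'x::metric_space \<Rightarrow> 'a::{metric_space, second_countable_topology}"
  assumes X: "compact X" "X \<noteq> {}"
    and meas: "\<And>x. x \<in> X \<Longrightarrow> (\<lambda>\<omega>. g \<omega> x) \<in> M \<rightarrow>\<^sub>M borel"
    and cont: "\<And>\<omega>. \<omega> \<in> space M \<Longrightarrow> continuous_on X (g \<omega>)"
    and F: "finite F" "F \<in> nonempty_compacts"
  shows "(\<lambda>\<omega>. hausdorff_dist F (g \<omega> ` X)) \<in> borel_measurable M"
proof (rule borel_measurable_iff_le[THEN iffD2, rule_format])
  fix r :: real
  obtain D where D: "countable D" "D \<subseteq> X" "X \<subseteq> closure D"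
    using compact_countable_dense[OF X(1)] .
  have [measurable]: "(\<lambda>\<omega>. g \<omega> x) \<in> M \<rightarrow>\<^sub>M borel" if "x \<in> D" for x
    using that D meas by blast
  have [measurable]: "(\<lambda>\<omega>. infdist a (g \<omega> ` X)) \<in> borel_measurable M" for a
  \<comment> \<open>Strict sublevel sets fit an infimum: it is below \<open>c\<close> exactly when
    some value is, whether or not it is attained on \<open>D\<close>.\<close>
  proof (rule borel_measurable_iff_less[THEN iffD2, rule_format])
    fix c :: real
    have "infdist a (g \<omega> ` X) < c \<longleftrightarrow> (\<exists>x\<in>D. dist a (g \<omega> x) < c)" if "\<omega> \<in> space M" for \<omega>
    proof -
      have "infdist a (g \<omega> ` X) < c \<longleftrightarrow> (\<exists>x\<in>X. dist a (g \<omega> x) < c)"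
        using X(2) by (auto simp: infdist_def cINF_less_iff)
      also have "\<dots> \<longleftrightarrow> (\<exists>x\<in>D. dist a (g \<omega> x) < c)"
        using that by (intro ex_less_dense_iff D continuous_intros cont)
      finally show ?thesis .
    qed
    then have "{\<omega> \<in> space M. infdist a (g \<omega> ` X) < c} =
      {\<omega> \<in> space M. \<exists>x\<in>D. dist a (g \<omega> x) < c}"
      by blast
    also have "\<dots> \<in> sets M"
      using D(1) by (intro sets.sets_Collect_countable_Ex') measurable
    finally show "{\<omega> \<in> space M. infdist a (g \<omega> ` X) < c} \<in> sets M" .
  qed
  have "hausdorff_dist F (g \<omega> ` X) \<le> r \<longleftrightarrow>
      (\<forall>a\<in>F. infdist a (g \<omega> ` X) \<le> r) \<and> (\<forall>x\<in>D. infdist (g \<omega> x) F \<le> r)"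
    if w: "\<omega> \<in> space M" for \<omega>
  proof -
    have "g \<omega> ` X \<in> nonempty_compacts"
      using X cont[OF w] by (simp add: nonempty_compacts_def compact_continuous_image)
    \<comment> \<open>The negated form says that the bound \<open>r\<close> is violated somewhere.
      The signs turn this into the strict upper inequality of \<open>ex_less_dense_iff\<close>, so
      the bound holds on all of \<open>X\<close> iff it holds on \<open>D\<close>.\<close>
    moreover have "(\<exists>x\<in>X. - infdist (g \<omega> x) F < - r) \<longleftrightarrow> (\<exists>x\<in>D. - infdist (g \<omega> x) F < - r)"
      using w by (intro ex_less_dense_iff D continuous_intros cont)
    ultimately show ?thesis
      using hausdorff_dist_le_iff[OF F(2)] by (auto simp: not_le[symmetric])
  qed
  then have "{\<omega> \<in> space M. hausdorff_dist F (g \<omega> ` X) \<le> r} =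
    {\<omega> \<in> space M. (\<forall>a\<in>F. infdist a (g \<omega> ` X) \<le> r) \<and> (\<forall>x\<in>D. infdist (g \<omega> x) F \<le> r)}"
    by blast
  also have "\<dots> \<in> sets M"
  proof (rule sets.sets_Collect_conj)
    show "{\<omega> \<in> space M. \<forall>a\<in>F. infdist a (g \<omega> ` X) \<le> r} \<in> sets M"
      by (rule sets.sets_Collect_finite_All[OF _ F(1)]) measurable
    have [measurable]: "(\<lambda>y. infdist y F) \<in> borel_measurable borel"
      by (intro borel_measurable_continuous_onI continuous_intros)
    show "{\<omega> \<in> space M. \<forall>x\<in>D. infdist (g \<omega> x) F \<le> r} \<in> sets M"
      by (rule sets.sets_Collect_countable_All'[OF _ D(1)]) measurable
  qed
  finally show "{\<omega> \<in> space M. hausdorff_dist F (g \<omega> ` X) \<le> r} \<in> sets M" .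
qed

theorem theorem4p7:
  fixes M :: "'w measure"
    and X :: "'x::metric_space set"
    and g :: "'w \<Rightarrow> 'x \<Rightarrow> complex ^ 'n"
  assumes "compact X" and "X \<noteq> {}"
    and "random_continuous_function M X g"
  shows "random_compact_set M (\<lambda>\<omega>. {g \<omega> x | x. x \<in> X})"
proof -
  have meas: "\<And>x. x \<in> X \<Longrightarrow> (\<lambda>\<omega>. g \<omega> x) \<in> M \<rightarrow>\<^sub>M borel"
    and cont: "\<And>\<omega>. \<omega> \<in> space M \<Longrightarrow> continuous_on X (g \<omega>)"
    using assms(3) by (auto simp: random_continuous_function_def)
  have "(\<lambda>\<omega>. g \<omega> ` X) \<in> M \<rightarrow>\<^sub>M hausdorff_borel"
  proof (rule measurable_hausdorff_borelI)
    show "g \<omega> ` X \<in> nonempty_compacts" if "\<omega> \<in> space M" for \<omega>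
      using assms(1,2) cont[OF that]
      by (simp add: nonempty_compacts_def compact_continuous_image)
  \<comment> \<open>The remaining goal is the measurability of the distance from each finite
    non-empty set to the image of \<open>X\<close>.\<close>
  qed (rule measurable_hausdorff_dist_image[OF assms(1,2) meas cont])
  then show ?thesis
    by (simp add: random_compact_set_def Setcompr_eq_image)
qed

end
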